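(* Suppose that $f:[0,1]\to\mathbb{R}$ is the restriction of an $\Omega$-bandlimited function with spectral measure $\mu$, where $\Omega>0$. Then for all integers $m\ge 1$ and $N\ge 1$, $$E_{m,N}[f]\le\frac{2|\mu|}{\pi}\,e^{\frac12\left(2^{-m}\Omega-N\right)}.$$ If $T$ is the quantized tensor representation of $f$ on $\mathcal{D}_K$ for some integer $K>m$, then it follows that, for every $\varepsilon>0$, $$r_m^{(\varepsilon,\infty)}[T]\le 1+\left\lceil 2^{-m}\Omega+2\log_+\left(\frac{2|\mu|}{\pi\varepsilon}\right)\right\rceil.$$
   Context: A function $f:\mathbb{R}\to\mathbb{R}$ is $\Omega$-bandlimited ($\Omega>0$) if $f(x)=\frac{1}{2\pi}\int e^{i\omega x}\,d\mu(\omega)$ for a signed measure $\mu$ supported on $[-\Omega,\Omega]$ with total variation $|\mu|<\infty$; $\mu$ is called the spectral measure of $f$. Here $|\mu|$ denotes the total variation (a number), and $\log_+(x)=\max\{\log x,0\}$ with $\log_+(0)=0$. Dyadic grid: $\mathcal{D}_K=(2^{-K}\mathbb{Z})\cap[0,1)$; each $x\in\mathcal{D}_K$ is written uniquely as $x=\sum_{k=1}^K 2^{-k}\sigma_k$ with $\sigma_k\in\{0,1\}$. The quantized tensor representation of $f:[0,1]\to\mathbb{R}$ on $\mathcal{D}_K$ is the tensor $T:\{0,1\}^K\to\mathbb{R}$, $T(\sigma_1,\dots,\sigma_K)=f\left(\sum_{k=1}^K 2^{-k}\sigma_k\right)$. Tensor norm: $\|S\|_\infty=\max_{\sigma\in\{0,1\}^K}|S(\sigma)|$.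 The $(\varepsilon,\infty)$ rank of the $m$-th unfolding matrix, denoted $r_m^{(\varepsilon,\infty)}[T]$, is the smallest $r$ such that $\left\|T-\sum_{\alpha=0}^{r-1}T_L^\alpha\otimes T_R^\alpha\right\|_\infty\le\varepsilon$ for some tensors $T_L^\alpha:\{0,1\}^m\to\mathbb{R}$ and $T_R^\alpha:\{0,1\}^{K-m}\to\mathbb{R}$, where $(T_L\otimes T_R)(\sigma_1,\dots,\sigma_K)=T_L(\sigma_1,\dots,\sigma_m)\,T_R(\sigma_{m+1},\dots,\sigma_K)$. Chebyshev-Lobatto grid on $[0,1]$: $c_N^\alpha=\frac{\cos(\pi\alpha/N)+1}{2}$, $\alpha=0,\dots,N$; $P_N^\alpha$ is the Lagrange basis polynomial of degree $N$ with $P_N^\alpha(c_N^\beta)=\delta^{\alpha\beta}$. Interpolation error: $E_{m,N}[f]=\max_{u\in[0,1-2^{-m}],\,v\in[0,1]}\left|f(u+2^{-m}v)-\sum_{\alpha=0}^N f(u+2^{-m}c_N^\alpha)P_N^\alpha(v)\right|$. *)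

theory Defs
  imports "HOL-Analysis.Analysis"
begin

definition signed_measure :: "'a measure \<Rightarrow> ('a set \<Rightarrow> real) \<Rightarrow> bool" where
  "signed_measure M \<mu> \<longleftrightarrow>
     \<mu> {} = 0 \<and>
     (\<forall>A :: nat \<Rightarrow> 'a set. range A \<subseteq> sets M \<longrightarrow> disjoint_family A \<longrightarrow>
        (\<lambda>i. \<mu> (A i)) sums \<mu> (\<Union>i. A i))"

definition total_variation :: "'a measure \<Rightarrow> ('a set \<Rightarrow> real) \<Rightarrow> ennreal" where
  "total_variation M \<mu> =
     (SUP P \<in> {P. finite P \<and> P \<subseteq> sets M \<and> partition_on (space M) P}. \<Sum>A\<in>P. ennreal \<bar>\<mu> A\<bar>)"

definition tv_norm :: "(real set \<Rightarrow> real) \<Rightarrow> real" where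
  "tv_norm \<mu> = enn2real (total_variation borel \<mu>)"

text \<open>
  The positive part of the Jordan decomposition. Since \<^const>\<open>ennreal\<close> sends negative reals to 0,
  only the sets of nonnegative measure contribute to the supremum. The negative part of \<open>\<mu>\<close> is the
  positive part of \<open>-\<mu>\<close>; see \<open>emeasure_pos_part\<close> and \<open>jordan_decomposition\<close> below.
\<close>

definition pos_part :: "'a measure \<Rightarrow> ('a set \<Rightarrow> real) \<Rightarrow> 'a measure" where
  "pos_part M \<mu> =
     measure_of (space M) (sets M) (\<lambda>A. SUP B \<in> {B \<in> sets M. B \<subseteq> A}. ennreal (\<mu> B))"

definition neg_part :: "'a measure \<Rightarrow> ('a set \<Rightarrow> real) \<Rightarrow> 'a measure" where
  "neg_part M \<mu> = pos_part M (\<lambda>A. - \<mu> A)"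

definition signed_integral ::
    "'a measure \<Rightarrow> ('a set \<Rightarrow> real) \<Rightarrow> ('a \<Rightarrow> 'b::{banach, second_countable_topology}) \<Rightarrow> 'b" where
  "signed_integral M \<mu> g = integral\<^sup>L (pos_part M \<mu>) g - integral\<^sup>L (neg_part M \<mu>) g"

lemma signed_measure_Un:
  assumes "signed_measure M \<mu>" "A \<in> sets M" "B \<in> sets M" "A \<inter> B = {}"
  shows "\<mu> (A \<union> B) = \<mu> A + \<mu> B"
proof -
  have "disjoint_family (binaryset A B)"
    using assms(4) by (auto simp: disjoint_family_on_def binaryset_def)
  moreover have "range (binaryset A B) \<subseteq> sets M"
    using assms(2,3) by (auto simp: range_binaryset_eq)
  ultimately have "(\<lambda>i. \<mu> (binaryset A B i)) sums \<mu> (A \<union> B)"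
    using assms(1) unfolding signed_measure_def by (metis UN_binaryset_eq)
  moreover have "(\<lambda>i. \<mu> (binaryset A B i)) sums (\<mu> A + \<mu> B)"
    using assms(1) by (intro binaryset_sums) (simp add: signed_measure_def)
  ultimately show ?thesis by (rule sums_unique2)
qed

lemma signed_measure_uminus: "signed_measure M \<mu> \<Longrightarrow> signed_measure M (\<lambda>A. - \<mu> A)"
  unfolding signed_measure_def by (auto intro: sums_minus)

lemma emeasure_pos_part:
  assumes \<mu>: "signed_measure M \<mu>" and A: "A \<in> sets M"
  shows "emeasure (pos_part M \<mu>) A = (SUP B \<in> {B \<in> sets M. B \<subseteq> A}. ennreal (\<mu> B))"
proof -
  define p where "p A = (SUP B \<in> {B \<in> sets M. B \<subseteq> A}. ennreal (\<mu> B))" for A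
  have upper: "ennreal (\<mu> B) \<le> p A" if "B \<in> sets M" "B \<subseteq> A" for A B
    unfolding p_def using that by (intro SUP_upper) auto
  have mono: "p A \<le> p B" if "A \<subseteq> B" for A B
    unfolding p_def using that by (intro SUP_subset_mono) auto
  have super: "p A + p B \<le> p (A \<union> B)" if AB: "A \<inter> B = {}" for A B
  proof -
    have ne: "{B \<in> sets M. B \<subseteq> A} \<noteq> {}" for A by auto
    have "ennreal (\<mu> C) + ennreal (\<mu> D) \<le> p (A \<union> B)"
      if C: "C \<in> sets M" "C \<subseteq> A" and D: "D \<in> sets M" "D \<subseteq> B" for C D
    proof (cases "0 \<le> \<mu> C \<and> 0 \<le> \<mu> D")
      case True
      have "\<mu> (C \<union> D) = \<mu> C + \<mu> D"
        using C D AB by (intro signed_measure_Un[OF \<mu>]) auto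
      then have "ennreal (\<mu> C) + ennreal (\<mu> D) = ennreal (\<mu> (C \<union> D))"
        using True by (simp add: ennreal_plus)
      also have "\<dots> \<le> p (A \<union> B)" using C D by (intro upper) auto
      finally show ?thesis .
    next
      case False
      moreover have "ennreal (\<mu> C) \<le> p (A \<union> B)" "ennreal (\<mu> D) \<le> p (A \<union> B)"
        using C D by (auto intro!: upper)
      ultimately show ?thesis by (auto simp: ennreal_neg)
    qed
    then have "ennreal (\<mu> C) + p B \<le> p (A \<union> B)" if "C \<in> sets M" "C \<subseteq> A" for C
      using that unfolding p_def[of B]
      by (subst ennreal_SUP_add_right[OF ne]) (auto intro!: SUP_least)
    then show ?thesis
      unfolding p_def[of A]
      by (subst ennreal_SUP_add_left[symmetric, OF ne]) (auto intro!: SUP_least)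
  qed
  have p_empty: "p {} = 0"
    using \<mu> by (intro antisym) (auto simp: p_def signed_measure_def intro!: SUP_least)
  have "(\<Sum>i. p (F i)) = p (\<Union>i. F i)"
    if F: "range F \<subseteq> sets M" "disjoint_family F" for F :: "nat \<Rightarrow> 'a set"
  proof (rule antisym)
    have "(\<Sum>i<n. p (F i)) \<le> p (\<Union>i<n. F i)" for n
    proof (induction n)
      case (Suc n)
      have "(\<Sum>i<Suc n. p (F i)) \<le> p (\<Union>i<n. F i) + p (F n)"
        using Suc by (simp add: add_right_mono)
      also have "\<dots> \<le> p ((\<Union>i<n. F i) \<union> F n)"
      proof (rule super)
        have "F i \<inter> F n = {}" if "i < n" for i
          using F(2) that by (intro disjoint_family_onD[of F UNIV]) auto
        then show "(\<Union>i<n. F i) \<inter> F n = {}" by blast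
      qed
      also have "(\<Union>i<n. F i) \<union> F n = (\<Union>i<Suc n. F i)" by (auto simp: less_Suc_eq)
      finally show ?case .
    qed (simp add: p_empty)
    also have "p (\<Union>i<n. F i) \<le> p (\<Union>i. F i)" for n by (intro mono) auto
    finally show "(\<Sum>i. p (F i)) \<le> p (\<Union>i. F i)" by (intro suminf_le_const) auto
  next
    have "ennreal (\<mu> B) \<le> (\<Sum>i. p (F i))" if B: "B \<in> sets M" "B \<subseteq> (\<Union>i. F i)" for B
    proof -
      have "range (\<lambda>i. B \<inter> F i) \<subseteq> sets M" "disjoint_family (\<lambda>i. B \<inter> F i)"
        using F B(1) by (auto simp: disjoint_family_on_def)
      moreover have "(\<Union>i. B \<inter> F i) = B" using B(2) by auto
      ultimately have "(\<lambda>i. \<mu> (B \<inter> F i)) sums \<mu> B"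
        using \<mu> unfolding signed_measure_def by metis
      then have lim: "(\<lambda>n. ennreal (\<Sum>i<n. \<mu> (B \<inter> F i))) \<longlonglongrightarrow> ennreal (\<mu> B)"
        unfolding sums_def by (rule tendsto_ennrealI)
      have "ennreal (\<Sum>i<n. \<mu> (B \<inter> F i)) \<le> (\<Sum>i. p (F i))" for n
      proof -
        have "ennreal (\<Sum>i<n. \<mu> (B \<inter> F i)) \<le> ennreal (\<Sum>i<n. max 0 (\<mu> (B \<inter> F i)))"
          by (intro ennreal_leI sum_mono) auto
        also have "\<dots> = (\<Sum>i<n. ennreal (max 0 (\<mu> (B \<inter> F i))))"
          by (subst sum_ennreal) auto
        also have "\<dots> \<le> (\<Sum>i<n. p (F i))"
        proof (rule sum_mono)
          fix i
          have "ennreal (\<mu> (B \<inter> F i)) \<le> p (F i)" using B(1) F(1) by (intro upper) auto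
          then show "ennreal (max 0 (\<mu> (B \<inter> F i))) \<le> p (F i)"
            by (auto simp: max_def ennreal_neg)
        qed
        also have "\<dots> \<le> (\<Sum>i. p (F i))" by (intro sum_le_suminf) auto
        finally show ?thesis .
      qed
      then show ?thesis by (intro LIMSEQ_le_const2[OF lim]) auto
    qed
    then show "p (\<Union>i. F i) \<le> (\<Sum>i. p (F i))"
      unfolding p_def[of "\<Union>i. F i"] by (intro SUP_least) auto
  qed
  then have "countably_additive (sets M) p" by (auto simp: countably_additive_def)
  moreover have "positive (sets M) p" by (simp add: positive_def p_empty)
  ultimately have "emeasure (measure_of (space M) (sets M) p) A = p A"
    using A by (intro emeasure_measure_of_sigma) (auto simp: sets.sigma_algebra_axioms)
  then show ?thesis by (simp add: pos_part_def flip: p_def)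
qed

lemma emeasure_pos_part_finite:
  assumes \<mu>: "signed_measure M \<mu>" and A: "A \<in> sets M" and fin: "total_variation M \<mu> < \<infinity>"
  shows "emeasure (pos_part M \<mu>) A < \<infinity>"
proof -
  have "ennreal (\<mu> B) \<le> total_variation M \<mu>" if B: "B \<in> sets M" for B
  proof -
    let ?P = "{B, space M - B} - {{}}"
    have "ennreal (\<mu> B) \<le> (\<Sum>A\<in>?P. ennreal \<bar>\<mu> A\<bar>)"
    proof (cases "B = {}")
      case True
      then show ?thesis using \<mu> by (simp add: signed_measure_def)
    next
      case False
      then have "(\<Sum>A\<in>{B}. ennreal \<bar>\<mu> A\<bar>) \<le> (\<Sum>A\<in>?P. ennreal \<bar>\<mu> A\<bar>)"
        by (intro sum_mono2) auto
      moreover have "ennreal (\<mu> B) \<le> ennreal \<bar>\<mu> B\<bar>" by (intro ennreal_leI) auto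
      ultimately show ?thesis by simp
    qed
    also have "\<dots> \<le> total_variation M \<mu>"
      unfolding total_variation_def using B sets.sets_into_space[OF B]
      by (intro SUP_upper) (auto simp: partition_on_def disjoint_def)
    finally show ?thesis .
  qed
  then have "emeasure (pos_part M \<mu>) A \<le> total_variation M \<mu>"
    unfolding emeasure_pos_part[OF \<mu> A] by (intro SUP_least) auto
  with fin show ?thesis by (rule order.strict_trans1[rotated])
qed

lemma total_variation_uminus: "total_variation M (\<lambda>A. - \<mu> A) = total_variation M \<mu>"
  by (simp add: total_variation_def)

lemma jordan_decomposition:
  assumes \<mu>: "signed_measure M \<mu>" and A: "A \<in> sets M" and fin: "total_variation M \<mu> < \<infinity>"
  shows "\<mu> A = measure (pos_part M \<mu>) A - measure (neg_part M \<mu>) A"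
proof -
  have le: "measure (pos_part M \<nu>) A \<le> \<nu> A + measure (neg_part M \<nu>) A"
    if \<nu>: "signed_measure M \<nu>" and fin: "total_variation M \<nu> < \<infinity>" for \<nu>
  proof -
    note \<nu>' = signed_measure_uminus[OF \<nu>]
    have neg: "ennreal (measure (neg_part M \<nu>) A) = emeasure (neg_part M \<nu>) A"
      using emeasure_pos_part_finite[OF \<nu>' A] fin
      by (simp add: neg_part_def total_variation_uminus emeasure_eq_ennreal_measure less_top)
    have pos: "ennreal (measure (pos_part M \<nu>) A) = emeasure (pos_part M \<nu>) A"
      using emeasure_pos_part_finite[OF \<nu> A fin]
      by (simp add: emeasure_eq_ennreal_measure less_top)
    have bound: "- \<nu> B \<le> measure (neg_part M \<nu>) A" if "B \<in> sets M" "B \<subseteq> A" for B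
    proof -
      have "ennreal (- \<nu> B) \<le> ennreal (measure (neg_part M \<nu>) A)"
        unfolding neg using that
        by (auto simp: neg_part_def emeasure_pos_part[OF \<nu>' A] intro!: SUP_upper)
      then show ?thesis by (simp add: ennreal_le_iff)
    qed
    have "ennreal (\<nu> B) \<le> ennreal (\<nu> A + measure (neg_part M \<nu>) A)"
      if B: "B \<in> sets M" "B \<subseteq> A" for B
    proof -
      have "\<nu> (B \<union> (A - B)) = \<nu> B + \<nu> (A - B)"
        using A B by (intro signed_measure_Un[OF \<nu>]) auto
      moreover have "B \<union> (A - B) = A" using B by auto
      moreover have "- \<nu> (A - B) \<le> measure (neg_part M \<nu>) A" using A B by (intro bound) auto
      ultimately show ?thesis by (intro ennreal_leI) simp
    qed
    then have "ennreal (measure (pos_part M \<nu>) A) \<le> ennreal (\<nu> A + measure (neg_part M \<nu>) A)"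
      unfolding pos by (auto simp: emeasure_pos_part[OF \<nu> A] intro!: SUP_least)
    moreover have "0 \<le> \<nu> A + measure (neg_part M \<nu>) A" using bound[OF A] by simp
    ultimately show ?thesis by (simp add: ennreal_le_iff)
  qed
  from le[OF \<mu> fin] le[OF signed_measure_uminus[OF \<mu>]] fin show ?thesis
    by (simp add: neg_part_def total_variation_uminus)
qed

definition bandlimited_with :: "real \<Rightarrow> (real set \<Rightarrow> real) \<Rightarrow> (real \<Rightarrow> real) \<Rightarrow> bool" where
  "bandlimited_with \<Omega> \<mu> g \<longleftrightarrow>
     signed_measure borel \<mu> \<and>
     total_variation borel \<mu> < \<infinity> \<and>
     (\<forall>A \<in> sets borel. A \<inter> {-\<Omega>..\<Omega>} = {} \<longrightarrow> \<mu> A = 0) \<and>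
     (\<forall>x. complex_of_real (g x) =
        1 / (2 * pi) * signed_integral borel \<mu> (\<lambda>\<omega>. exp (\<i> * of_real (\<omega> * x))))"

definition log_plus :: "real \<Rightarrow> real" where
  "log_plus x = (if x > 0 then max (ln x) 0 else 0)"

definition cheb_node :: "nat \<Rightarrow> nat \<Rightarrow> real" where
  "cheb_node N \<alpha> = (cos (pi * real \<alpha> / real N) + 1) / 2"

definition lagrange_basis :: "nat \<Rightarrow> nat \<Rightarrow> real \<Rightarrow> real" where
  "lagrange_basis N \<alpha> v =
     (\<Prod>\<beta> \<in> {0..N} - {\<alpha>}. (v - cheb_node N \<beta>) / (cheb_node N \<alpha> - cheb_node N \<beta>))"

lemma lagrange_basis_cheb_node:
  assumes "N \<ge> 1" "\<alpha> \<le> N" "\<beta> \<le> N"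
  shows "lagrange_basis N \<alpha> (cheb_node N \<beta>) = (if \<alpha> = \<beta> then 1 else 0)"
proof -
  have "cheb_node N \<alpha> \<noteq> cheb_node N \<gamma>" if "\<gamma> \<le> N" "\<gamma> \<noteq> \<alpha>" for \<gamma>
  proof
    assume "cheb_node N \<alpha> = cheb_node N \<gamma>"
    then have "cos (pi * real \<alpha> / real N) = cos (pi * real \<gamma> / real N)"
      by (simp add: cheb_node_def)
    moreover have "0 \<le> pi * real k / real N" "pi * real k / real N \<le> pi" if "k \<le> N" for k
      using assms(1) that by (simp_all add: divide_le_eq)
    ultimately have "pi * real \<alpha> / real N = pi * real \<gamma> / real N"
      using assms(2) that(1) by (metis cos_inj_pi)
    with assms that show False by simp
  qed
  then have ne: "cheb_node N \<alpha> - cheb_node N \<gamma> \<noteq> 0" if "\<gamma> \<in> {0..N} - {\<alpha>}" for \<gamma>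
    using that by simp
  show ?thesis
  proof (cases "\<alpha> = \<beta>")
    case True
    with ne show ?thesis by (simp add: lagrange_basis_def del: right_minus_eq)
  next
    case False
    with assms(3) show ?thesis by (auto simp: lagrange_basis_def)
  qed
qed

definition interp_err :: "nat \<Rightarrow> nat \<Rightarrow> (real \<Rightarrow> real) \<Rightarrow> real \<Rightarrow> real \<Rightarrow> real" where
  "interp_err m N f u v =
     \<bar>f (u + v / 2 ^ m) - (\<Sum>\<alpha> = 0..N. f (u + cheb_node N \<alpha> / 2 ^ m) * lagrange_basis N \<alpha> v)\<bar>"

text \<open>For continuous \<open>f\<close> this supremum is attained; see \<open>interp_error_is_max\<close>.\<close>

definition interp_error :: "nat \<Rightarrow> nat \<Rightarrow> (real \<Rightarrow> real) \<Rightarrow> real" where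
  "interp_error m N f = (SUP (u, v) \<in> {0 .. 1 - 1 / 2 ^ m} \<times> {0..1}. interp_err m N f u v)"

lemma interp_error_is_max:
  assumes f: "continuous_on {0..1} f"
  obtains u v where "u \<in> {0 .. 1 - 1 / 2 ^ m}" "v \<in> {0..1}"
    "interp_error m N f = interp_err m N f u v"
    "\<And>u' v'. u' \<in> {0 .. 1 - 1 / 2 ^ m} \<Longrightarrow> v' \<in> {0..1} \<Longrightarrow>
       interp_err m N f u' v' \<le> interp_error m N f"
proof -
  let ?S = "{0 .. 1 - 1 / 2 ^ m :: real} \<times> {0 .. 1 :: real}"
  let ?g = "\<lambda>(u, v). interp_err m N f u v"
  have node: "cheb_node N \<alpha> \<in> {0..1}" for \<alpha>
  proof -
    define c where "c = cos (pi * real \<alpha> / real N)"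
    have "- 1 \<le> c" "c \<le> 1" unfolding c_def by (rule cos_ge_minus_one, rule cos_le_one)
    then show ?thesis by (simp add: cheb_node_def flip: c_def)
  qed
  have mem: "u + v / 2 ^ m \<in> {0..1}" if "u \<in> {0 .. 1 - 1 / 2 ^ m}" "v \<in> {0..1}" for u v :: real
  proof -
    have "v / 2 ^ m \<le> 1 / 2 ^ m" using that by (intro divide_right_mono) auto
    then show ?thesis using that by simp
  qed
  have "continuous_on ?S (\<lambda>z. f (fst z + snd z / 2 ^ m))"
    by (rule continuous_on_compose2[OF f]) (intro continuous_intros image_subsetI mem; auto)+
  moreover have "continuous_on ?S (\<lambda>z. f (fst z + cheb_node N \<alpha> / 2 ^ m))" for \<alpha>
    by (rule continuous_on_compose2[OF f]) (intro continuous_intros image_subsetI mem node; auto)+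
  moreover have "continuous_on ?S (\<lambda>z. lagrange_basis N \<alpha> (snd z))" for \<alpha>
    unfolding lagrange_basis_def divide_inverse by (intro continuous_intros)
  ultimately have cont: "continuous_on ?S ?g"
    unfolding interp_err_def case_prod_unfold by (intro continuous_intros)
  have ne: "?S \<noteq> {}" by auto
  obtain z where z: "z \<in> ?S" "\<And>y. y \<in> ?S \<Longrightarrow> ?g y \<le> ?g z"
    using continuous_attains_sup[OF _ ne cont] by (blast intro: compact_Times compact_Icc)
  then have "interp_error m N f = ?g z"
    unfolding interp_error_def by (intro cSup_eq_maximum) auto
  then show thesis using z by (intro that[of "fst z" "snd z"]) (auto simp: case_prod_unfold)
qed

text \<open>
  A tensor \<open>{0,1}\<^sup>K \<rightarrow> \<real>\<close> is a function on lists of which only the values on \<open>bits K\<close> matter;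
  the list \<open>s\<close> stands for \<open>(\<sigma>\<^sub>1, \<dots>, \<sigma>\<^sub>K)\<close>, so \<open>\<sigma>\<^sub>k\<close> is \<open>s ! (k - 1)\<close>.
\<close>

definition bits :: "nat \<Rightarrow> nat list set" where
  "bits K = {s. length s = K \<and> set s \<subseteq> {0, 1}}"

definition quantized_tensor :: "nat \<Rightarrow> (real \<Rightarrow> real) \<Rightarrow> nat list \<Rightarrow> real" where
  "quantized_tensor K f s = f (\<Sum>k = 1..K. real (s ! (k - 1)) / 2 ^ k)"

definition tensor_norm :: "nat \<Rightarrow> (nat list \<Rightarrow> real) \<Rightarrow> real" where
  "tensor_norm K S = (MAX s \<in> bits K. \<bar>S s\<bar>)"

definition tensor_prod ::
    "nat \<Rightarrow> (nat list \<Rightarrow> real) \<Rightarrow> (nat list \<Rightarrow> real) \<Rightarrow> nat list \<Rightarrow> real" where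
  "tensor_prod m L R s = L (take m s) * R (drop m s)"

definition eps_rank :: "nat \<Rightarrow> nat \<Rightarrow> real \<Rightarrow> (nat list \<Rightarrow> real) \<Rightarrow> nat" where
  "eps_rank K m \<epsilon> T =
     (LEAST r. \<exists>L R :: nat \<Rightarrow> nat list \<Rightarrow> real.
        tensor_norm K (\<lambda>s. T s - (\<Sum>\<alpha><r. tensor_prod m (L \<alpha>) (R \<alpha>) s)) \<le> \<epsilon>)"

end

theory Submission
  imports Defs "HOL-Computational_Algebra.Polynomial"
begin

text \<open>
  Interpolation is linear, so the interpolation error of \<open>f\<close> is \<open>1 / (2 * pi)\<close> times the integral
  against \<open>\<mu>\<close> of the interpolation error of the exponentials \<open>x \<mapsto> cis (\<omega> * x)\<close> with
  \<open>\<bar>\<omega>\<bar> \<le> \<Omega>\<close>. On a dyadic interval of length \<open>1 / 2 ^ m\<close>, and up to a factor of modulus 1, these are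
  the functions \<open>v \<mapsto> cis (a * v)\<close> on \<open>[0, 1]\<close> with \<open>a = \<omega> / 2 ^ m\<close>.

  For a single exponential, a rotation turns the modulus of the error into the error of a real
  function \<open>t \<mapsto> cos (a * t - \<phi>)\<close>, whose derivative of order \<open>n = N + 1\<close> is bounded by
  \<open>\<bar>a\<bar> ^ n\<close> in absolute value. The
  Lagrange remainder (\<open>lagrange_remainder_bound\<close>), together with the bound \<open>4 / 4 ^ n\<close> on the nodal
  polynomial of the Chebyshev-Lobatto grid (\<open>prod_cheb_node_bound\<close>), gives an error of at most
  \<open>4 * (\<bar>a\<bar> / 4) ^ n / n! = 4 * (1 / 2) ^ n * ((\<bar>a\<bar> / 2) ^ n / n!)\<close>. The last factor is a term of the
  series of \<open>exp (\<bar>a\<bar> / 2)\<close>, and \<open>1 / 2 \<le> exp (- 1 / 2)\<close>; hence the bound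
  \<open>4 * exp ((\<bar>a\<bar> - N) / 2)\<close> of \<open>cis_interp_bound\<close>. Integration multiplies it by at most the total
  variation of \<open>\<mu>\<close>, because the masses of the two Jordan parts add up to at most that
  (\<open>norm_signed_integral_le\<close>).

  For the rank, split a point of the dyadic grid after \<open>m\<close> binary digits as \<open>u + v / 2 ^ m\<close>. The
  interpolant of \<open>f\<close> in \<open>v\<close> is a sum of \<open>N + 1\<close> products of a function of \<open>u\<close> and a function of \<open>v\<close>,
  so the rank is at most \<open>N + 1\<close> as soon as the interpolation error is at most \<open>\<epsilon>\<close>
  (\<open>eps_rank_le_interp\<close>). The claimed bound is what the smallest integer \<open>N\<close> with
  \<open>N \<ge> \<Omega> / 2 ^ m + 2 * log_plus (2 * |\<mu>| / (pi * \<epsilon>))\<close> yields.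
\<close>

section \<open>The Lagrange remainder\<close>

text \<open>
  The zeros of \<open>f'\<close> are constructed from left to right, one in each gap of \<open>S\<close>. The clause \<open>x < y\<close>
  is what makes the zero found to the right of \<open>Max A\<close> in the induction step a new one.
\<close>

lemma Rolle_finite_set:
  fixes f f' :: "real \<Rightarrow> real"
  assumes "finite S" and "S \<noteq> {}"
    and deriv: "\<And>x. (f has_real_derivative f' x) (at x)"
    and "\<And>x. x \<in> S \<Longrightarrow> f x = 0"
  shows "\<exists>S'. finite S' \<and> Suc (card S') = card S \<and> (\<forall>x\<in>S'. f' x = 0 \<and> (\<exists>y\<in>S. x < y))"
  using assms(1,2,4)
proof (induction S rule: finite_linorder_max_induct)
  case empty
  then show ?case by simp
next
  case (insert b A)
  show ?case
  proof (cases "A = {}")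
    case True
    then show ?thesis by (intro exI[of _ "{}"]) auto
  next
    case False
    have "f x = 0" if "x \<in> A" for x using that by (intro insert.prems) simp
    from insert.IH[OF False this] obtain S' where S': "finite S'" "Suc (card S') = card A"
      "\<forall>x\<in>S'. f' x = 0 \<and> (\<exists>y\<in>A. x < y)" by blast
    define a where "a = Max A"
    have a: "a \<in> A" using insert(1) False by (simp add: a_def)
    have "\<exists>z. a < z \<and> z < b \<and> f' z = 0"
    proof -
      have "\<exists>z. a < z \<and> z < b \<and> (*) (f' z) = (\<lambda>v. 0)"
      proof (rule Rolle_deriv)
        show "a < b" using insert(2) a by auto
        show "f a = f b" using insert(5) a by simp
        show "continuous_on {a..b} f"
          using deriv by (intro DERIV_continuous_on) (auto intro: DERIV_subset)
        show "(f has_derivative (*) (f' x)) (at x)" for x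
          using deriv[of x] by (simp add: has_field_derivative_def)
      qed
      then show ?thesis by (metis mult.right_neutral)
    qed
    then obtain z where z: "a < z" "z < b" "f' z = 0" by auto
    have below: "x < z" if "x \<in> S'" for x
    proof -
      from bspec[OF S'(3) that] obtain y where "y \<in> A" "x < y" by (elim conjE bexE)
      moreover have "y \<le> a" using insert(1) \<open>y \<in> A\<close> by (simp add: a_def)
      ultimately show ?thesis using z(1) by linarith
    qed
    have "z \<notin> S'" using below by auto
    moreover have "b \<notin> A" using insert(2) by auto
    ultimately show ?thesis
      using S' z insert(1) by (intro exI[of _ "insert z S'"]) auto
  qed
qed

lemma iterated_Rolle:
  fixes F :: "nat \<Rightarrow> real \<Rightarrow> real"
  assumes "\<And>k x. (F k has_real_derivative F (Suc k) x) (at x)"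
    and "finite S" and "card S = Suc n" and "\<And>x. x \<in> S \<Longrightarrow> F 0 x = 0"
  shows "\<exists>x. F n x = 0"
  using assms
proof (induction n arbitrary: F S)
  case 0
  then obtain x where "x \<in> S" by (metis card.empty ex_in_conv nat.distinct(1))
  then show ?case using 0 by auto
next
  case (Suc n)
  have "S \<noteq> {}" using Suc.prems(3) by auto
  then obtain S' where "finite S'" "Suc (card S') = card S" "\<forall>x\<in>S'. F (Suc 0) x = 0"
    using Rolle_finite_set[of S "F 0" "F (Suc 0)"] Suc.prems by blast
  then show ?case
    using Suc.IH[of "\<lambda>k. F (Suc k)" S'] Suc.prems by auto
qed

lemma inj_on_cheb_node:
  assumes "N \<ge> 1"
  shows "inj_on (cheb_node N) {0..N}"
proof (rule inj_onI)
  fix \<alpha> \<beta> assume "\<alpha> \<in> {0..N}" "\<beta> \<in> {0..N}" "cheb_node N \<alpha> = cheb_node N \<beta>"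
  then show "\<alpha> = \<beta>"
    using lagrange_basis_cheb_node[OF assms, of \<alpha> \<alpha>] lagrange_basis_cheb_node[OF assms, of \<alpha> \<beta>]
    by (auto split: if_splits)
qed

lemma coeff_prod_linear:
  fixes c :: "'b \<Rightarrow> 'a::idom"
  assumes "finite A"
  shows "degree (\<Prod>\<alpha>\<in>A. [:- c \<alpha>, 1:]) = card A"
    and "coeff (\<Prod>\<alpha>\<in>A. [:- c \<alpha>, 1:]) (card A) = 1"
proof -
  show deg: "degree (\<Prod>\<alpha>\<in>A. [:- c \<alpha>, 1:]) = card A"
    by (subst degree_prod_sum_eq) auto
  have "lead_coeff (\<Prod>\<alpha>\<in>A. [:- c \<alpha>, 1:]) = 1"
    by (simp add: lead_coeff_prod)
  then show "coeff (\<Prod>\<alpha>\<in>A. [:- c \<alpha>, 1:]) (card A) = 1"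
    unfolding deg .
qed

text \<open>The Lagrange basis functions \<^const>\<open>lagrange_basis\<close> as elements of the polynomial ring.\<close>

definition lagrange_poly :: "nat \<Rightarrow> nat \<Rightarrow> real poly" where
  "lagrange_poly N \<alpha> =
     (\<Prod>\<beta> \<in> {0..N} - {\<alpha>}. smult (1 / (cheb_node N \<alpha> - cheb_node N \<beta>)) [:- cheb_node N \<beta>, 1:])"

lemma poly_lagrange_poly: "poly (lagrange_poly N \<alpha>) v = lagrange_basis N \<alpha> v"
  by (simp add: lagrange_poly_def lagrange_basis_def poly_prod diff_divide_distrib)

lemma degree_lagrange_poly:
  assumes "\<alpha> \<le> N"
  shows "degree (lagrange_poly N \<alpha>) \<le> N"
proof -
  have "degree (lagrange_poly N \<alpha>) \<le> (\<Sum>\<beta> \<in> {0..N} - {\<alpha>}. 1)"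
    unfolding lagrange_poly_def
    by (rule order_trans[OF degree_prod_sum_le])
       (simp_all only: o_def finite_Diff finite_atLeastAtMost,
        intro sum_mono order_trans[OF degree_smult_le], simp)
  also have "\<dots> = N" using assms by simp
  finally show ?thesis .
qed

text \<open>
  The family \<open>h\<close> consists of a function \<open>h 0\<close> and its successive derivatives. The proof is the
  classical one: for \<open>v\<close> off the grid, subtract from \<open>h 0\<close> its interpolant plus the multiple of the
  nodal polynomial that makes the difference vanish also at \<open>v\<close>. By Rolle's theorem the derivative
  of order \<open>N + 1\<close> of this difference has a zero \<open>\<xi>\<close>.
\<close>

lemma lagrange_remainder_bound:
  fixes h :: "nat \<Rightarrow> real \<Rightarrow> real"
  assumes N: "N \<ge> 1"
    and deriv: "\<And>k x. (h k has_real_derivative h (Suc k) x) (at x)"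
    and bound: "\<And>x. \<bar>h (Suc N) x\<bar> \<le> B"
  shows "\<bar>h 0 v - (\<Sum>\<alpha>=0..N. h 0 (cheb_node N \<alpha>) * lagrange_basis N \<alpha> v)\<bar>
           \<le> B / fact (Suc N) * \<bar>\<Prod>\<alpha>=0..N. v - cheb_node N \<alpha>\<bar>"
proof -
  define p where "p = (\<Sum>\<alpha>=0..N. smult (h 0 (cheb_node N \<alpha>)) (lagrange_poly N \<alpha>))"
  define w where "w = (\<Prod>\<alpha>=0..N. [:- cheb_node N \<alpha>, 1:])"
  have poly_p: "poly p t = (\<Sum>\<alpha>=0..N. h 0 (cheb_node N \<alpha>) * lagrange_basis N \<alpha> t)" for t
    by (simp add: p_def poly_sum poly_lagrange_poly)
  have poly_w: "poly w t = (\<Prod>\<alpha>=0..N. t - cheb_node N \<alpha>)" for t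
    by (simp add: w_def poly_prod)
  have p_node: "poly p (cheb_node N \<beta>) = h 0 (cheb_node N \<beta>)" if "\<beta> \<le> N" for \<beta>
    unfolding poly_p using that N
    by (simp add: lagrange_basis_cheb_node if_distrib[of "\<lambda>x. _ * x"] sum.delta cong: if_cong)
  have w_node: "poly w (cheb_node N \<beta>) = 0" if "\<beta> \<le> N" for \<beta>
    unfolding poly_w using that by (intro prod_zero) auto
  have deg_p: "degree p \<le> N"
    unfolding p_def
    by (intro degree_sum_le) (auto intro: degree_lagrange_poly order_trans[OF degree_smult_le])
  have deg_w: "degree w = Suc N" and coeff_w: "coeff w (Suc N) = 1"
    using coeff_prod_linear[of "{0..N}" "cheb_node N"] by (simp_all add: w_def)
  have "\<bar>h 0 v - poly p v\<bar> \<le> B / fact (Suc N) * \<bar>poly w v\<bar>"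
  proof (cases "v \<in> cheb_node N ` {0..N}")
    case True
    then show ?thesis using p_node w_node by auto
  next
    case False
    then have w0: "poly w v \<noteq> 0" by (auto simp: poly_w)
    define K where "K = (h 0 v - poly p v) / poly w v"
    define P where "P = p + smult K w"
    define F where "F k t = h k t - poly ((pderiv ^^ k) P) t" for k t
    have "\<exists>x. F (Suc N) x = 0"
    proof (rule iterated_Rolle)
      show "(F k has_real_derivative F (Suc k) x) (at x)" for k x
        unfolding F_def by (auto intro!: derivative_eq_intros deriv poly_DERIV)
      show "finite (insert v (cheb_node N ` {0..N}))" by simp
      show "card (insert v (cheb_node N ` {0..N})) = Suc (Suc N)"
        using False by (simp add: card_image[OF inj_on_cheb_node[OF N]])
      show "F 0 x = 0" if "x \<in> insert v (cheb_node N ` {0..N})" for x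
        using that w0 p_node w_node by (auto simp: F_def P_def K_def)
    qed
    then obtain \<xi> where \<xi>: "h (Suc N) \<xi> = poly ((pderiv ^^ Suc N) P) \<xi>"
      by (auto simp: F_def)
    \<comment> \<open>The derivative of order \<open>N + 1\<close> of \<open>P\<close> is the constant \<open>(N + 1)! * K\<close>.\<close>
    have "degree P \<le> Suc N"
      unfolding P_def using deg_p deg_w
      by (intro degree_add_le order_trans[OF degree_smult_le]) auto
    then have "degree ((pderiv ^^ Suc N) P) = 0"
      by (simp only: degree_higher_pderiv)
    then obtain c where c: "(pderiv ^^ Suc N) P = [:c:]" by (rule degree_eq_zeroE)
    have "c = coeff ((pderiv ^^ Suc N) P) 0" by (simp only: c coeff_pCons_0)
    also have "\<dots> = fact (Suc N) * coeff P (Suc N)"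
      by (simp only: coeff_higher_pderiv pochhammer_fact) simp
    also have "coeff P (Suc N) = K"
      using deg_p coeff_w by (simp add: P_def coeff_eq_0)
    finally have "h (Suc N) \<xi> = fact (Suc N) * K"
      using \<xi> c by simp
    then have "K = h (Suc N) \<xi> / fact (Suc N)" by simp
    then have "\<bar>K\<bar> \<le> B / fact (Suc N)"
      using bound[of \<xi>] by (simp add: divide_right_mono del: fact_Suc)
    then have "\<bar>K\<bar> * \<bar>poly w v\<bar> \<le> B / fact (Suc N) * \<bar>poly w v\<bar>"
      by (rule mult_right_mono) simp
    moreover have "h 0 v - poly p v = K * poly w v" using w0 by (simp add: K_def)
    ultimately show ?thesis by (simp only: abs_mult)
  qed
  then show ?thesis by (simp only: poly_p poly_w)
qed

section \<open>The nodal polynomial\<close>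

text \<open>
  Chebyshev polynomials of the second kind, with the index shifted by one: \<open>cheb_U n\<close> is the
  polynomial usually written \<open>U\<^bsub>n-1\<^esub>\<close>, with \<open>U\<^bsub>-1\<^esub> = 0\<close>.
\<close>

fun cheb_U :: "nat \<Rightarrow> real poly" where
  "cheb_U 0 = 0"
| "cheb_U (Suc 0) = 1"
| "cheb_U (Suc (Suc n)) = [:0, 2:] * cheb_U (Suc n) - cheb_U n"

lemma sin_times_cheb_U: "sin \<theta> * poly (cheb_U n) (cos \<theta>) = sin (real n * \<theta>)"
proof (induction n rule: cheb_U.induct)
  case (3 n)
  have "sin \<theta> * poly (cheb_U (Suc (Suc n))) (cos \<theta>) =
      2 * cos \<theta> * (sin \<theta> * poly (cheb_U (Suc n)) (cos \<theta>)) - sin \<theta> * poly (cheb_U n) (cos \<theta>)"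
    by (simp add: algebra_simps)
  also have "\<dots> = 2 * cos \<theta> * sin (real (Suc n) * \<theta>) - sin (real n * \<theta>)"
    using 3 by simp
  also have "\<dots> = sin (real (Suc n) * \<theta> + \<theta>)"
  proof -
    have "sin (real n * \<theta>) = sin (real (Suc n) * \<theta> - \<theta>)" by (simp add: algebra_simps)
    then show ?thesis by (simp only: sin_add sin_diff) simp
  qed
  finally show ?case by (simp add: algebra_simps)
qed simp_all

lemma cheb_U_degree: "degree (cheb_U n) \<le> n - 1"
  and coeff_cheb_U: "coeff (cheb_U (Suc n)) n = 2 ^ n"
proof -
  show deg: "degree (cheb_U n) \<le> n - 1" for n
  proof (induction n rule: cheb_U.induct)
    case (3 n)
    have "degree ([:0, 2:] * cheb_U (Suc n)) \<le> Suc n"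
      using 3(1) by (intro order_trans[OF degree_mult_le]) simp
    then show ?case using 3 by (auto intro!: degree_diff_le)
  qed simp_all
  show "coeff (cheb_U (Suc n)) n = 2 ^ n"
  proof (induction n)
    case (Suc n)
    have "coeff (cheb_U n) (Suc n) = 0"
      using deg[of n] by (intro coeff_eq_0) auto
    then show ?case using Suc by simp
  qed simp
qed

text \<open>
  In the variable \<open>x = 2 * v - 1 = cos \<theta>\<close> the nodes are the \<open>N + 1\<close> points \<open>cos (pi * \<alpha> / N)\<close>, which
  are the zeros of \<open>Q = (x\<^sup>2 - 1) * cheb_U N\<close>. Since \<open>Q\<close> has degree \<open>N + 1\<close> and leading coefficient
  \<open>2 ^ (N - 1)\<close>, it is that multiple of the nodal polynomial \<open>w\<close>, while
  \<open>Q (cos \<theta>) = - (sin \<theta> * sin (N * \<theta>))\<close> is at most 1 in modulus.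
\<close>

lemma prod_cheb_node_bound:
  assumes N: "N \<ge> 1" and v: "v \<in> {0..1}"
  shows "\<bar>\<Prod>\<alpha>=0..N. v - cheb_node N \<alpha>\<bar> \<le> 4 / 4 ^ Suc N"
proof -
  define x where "x \<alpha> = cos (pi * real \<alpha> / real N)" for \<alpha>
  define w where "w = (\<Prod>\<alpha>=0..N. [:- x \<alpha>, 1:])"
  define Q where "Q = [:-1, 0, 1:] * cheb_U N"
  have poly_Q: "poly Q (cos \<theta>) = - (sin \<theta> * sin (real N * \<theta>))" for \<theta>
  proof -
    have "poly Q (cos \<theta>) = - ((sin \<theta>)\<^sup>2 * poly (cheb_U N) (cos \<theta>))"
      unfolding sin_squared_eq by (simp add: Q_def power2_eq_square algebra_simps)
    also have "\<dots> = - (sin \<theta> * sin (real N * \<theta>))"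
      by (simp add: power2_eq_square mult.assoc sin_times_cheb_U)
    finally show ?thesis .
  qed
  have x_inj: "inj_on x {0..N}"
  proof (rule inj_onI)
    fix \<alpha> \<beta> assume "\<alpha> \<in> {0..N}" "\<beta> \<in> {0..N}" "x \<alpha> = x \<beta>"
    then show "\<alpha> = \<beta>"
      using inj_on_cheb_node[OF N] by (auto simp: cheb_node_def x_def inj_on_def)
  qed
  have Q_eq: "Q = smult (2 ^ (N - 1)) w"
  proof (rule poly_eqI_degree_lead_coeff)
    have "degree Q \<le> 2 + (N - 1)"
      unfolding Q_def using cheb_U_degree[of N] by (intro order_trans[OF degree_mult_le]) simp
    then show deg_Q: "degree Q \<le> Suc N" using N by simp
    show "degree (smult (2 ^ (N - 1)) w) \<le> Suc N"
      using coeff_prod_linear(1)[of "{0..N}" x] by (simp add: w_def)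
    obtain M where M: "N = Suc M" using N by (cases N) auto
    have "coeff (cheb_U N) (Suc N) = 0" using cheb_U_degree[of N] by (intro coeff_eq_0) auto
    then have "coeff Q (Suc N) = 2 ^ (N - 1)"
      using M coeff_cheb_U[of M] by (simp add: Q_def)
    then show "coeff Q (Suc N) = coeff (smult (2 ^ (N - 1)) w) (Suc N)"
      using coeff_prod_linear(2)[of "{0..N}" x] by (simp add: w_def)
    show "Suc N \<le> card (x ` {0..N})" by (simp add: card_image[OF x_inj])
    fix z assume "z \<in> x ` {0..N}"
    then obtain \<alpha> where \<alpha>: "\<alpha> \<le> N" "z = x \<alpha>" by auto
    have "poly w z = 0" unfolding w_def poly_prod using \<alpha> by (intro prod_zero) auto
    moreover have "poly Q z = 0"
      using N by (simp add: \<alpha> x_def poly_Q)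
    ultimately show "poly Q z = poly (smult (2 ^ (N - 1)) w) z" by simp
  qed
  define \<theta> where "\<theta> = arccos (2 * v - 1)"
  have \<theta>: "cos \<theta> = 2 * v - 1" using v by (simp add: \<theta>_def)
  have "\<bar>poly Q (cos \<theta>)\<bar> \<le> 1 * 1"
    unfolding poly_Q abs_minus_cancel abs_mult by (intro mult_mono) auto
  then have w_le: "2 ^ (N - 1) * \<bar>poly w (cos \<theta>)\<bar> \<le> 1"
    unfolding Q_eq by (simp add: abs_mult)
  have w_eq: "poly w (cos \<theta>) = 2 ^ Suc N * (\<Prod>\<alpha>=0..N. v - cheb_node N \<alpha>)"
  proof -
    have "poly w (cos \<theta>) = (\<Prod>\<alpha>=0..N. 2 * (v - cheb_node N \<alpha>))"
      unfolding w_def poly_prod \<theta> by (intro prod.cong) (auto simp: cheb_node_def x_def field_simps)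
    also have "\<dots> = (\<Prod>\<alpha>=0..N. 2) * (\<Prod>\<alpha>=0..N. v - cheb_node N \<alpha>)"
      by (rule prod.distrib)
    finally show ?thesis by simp
  qed
  have four: "2 ^ (N - 1) * 2 ^ Suc N * 4 = (4::real) ^ Suc N"
  proof -
    obtain M where M: "N = Suc M" using N by (cases N) auto
    have "(4::real) ^ M = (2 * 2) ^ M" by simp
    also have "\<dots> = 2 ^ M * 2 ^ M" by (rule power_mult_distrib)
    finally show ?thesis by (simp add: M)
  qed
  have "4 ^ Suc N * \<bar>\<Prod>\<alpha>=0..N. v - cheb_node N \<alpha>\<bar> = 4 * (2 ^ (N - 1) * \<bar>poly w (cos \<theta>)\<bar>)"
    unfolding w_eq abs_mult four[symmetric] by simp
  also have "\<dots> \<le> 4" using w_le by simp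
  finally show ?thesis by (simp add: pos_le_divide_eq mult.commute del: power_Suc)
qed

section \<open>Interpolation of an exponential\<close>

text \<open>
  With \<open>Z\<close> the complex error and \<open>\<phi>\<close> its argument, \<open>norm Z\<close> is the real part of \<open>cis (- \<phi>) * Z\<close>,
  which is the interpolation error of \<open>t \<mapsto> cos (a * t - \<phi>)\<close>.
\<close>

lemma cis_interp_bound:
  fixes a v :: real
  assumes N: "N \<ge> 1" and v: "v \<in> {0..1}"
  shows "norm (cis (a * v) -
      (\<Sum>\<alpha>=0..N. cis (a * cheb_node N \<alpha>) * of_real (lagrange_basis N \<alpha> v)))
    \<le> 4 * exp ((\<bar>a\<bar> - real N) / 2)"
proof -
  define Z where "Z = cis (a * v) -
      (\<Sum>\<alpha>=0..N. cis (a * cheb_node N \<alpha>) * of_real (lagrange_basis N \<alpha> v))"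
  define \<phi> where "\<phi> = Arg Z"
  define h where "h k t = a ^ k * cos (a * t - \<phi> + real k * (pi / 2))" for k t
  have "norm Z = Re (cis (- \<phi>) * Z)"
  proof -
    have "Z = of_real (norm Z) * cis \<phi>"
      by (metis \<phi>_def rcis_def rcis_cmod_Arg)
    then have "cis (- \<phi>) * Z = of_real (norm Z)"
      by (metis (no_types, opaque_lifting) cis_mult cis_zero add.left_inverse mult.assoc mult.commute mult.right_neutral)
    then show ?thesis by simp
  qed
  also have "cis (- \<phi>) * Z = cis (a * v - \<phi>) -
      (\<Sum>\<alpha>=0..N. cis (a * cheb_node N \<alpha> - \<phi>) * of_real (lagrange_basis N \<alpha> v))"
    by (simp add: Z_def right_diff_distrib sum_distrib_left mult.assoc[symmetric] cis_mult)
  also have "Re \<dots> = h 0 v - (\<Sum>\<alpha>=0..N. h 0 (cheb_node N \<alpha>) * lagrange_basis N \<alpha> v)"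
    by (simp add: h_def)
  also have "\<dots> \<le> \<bar>\<dots>\<bar>" by simp
  also have "\<dots> \<le> \<bar>a\<bar> ^ Suc N / fact (Suc N) * \<bar>\<Prod>\<alpha>=0..N. v - cheb_node N \<alpha>\<bar>"
  proof (rule lagrange_remainder_bound[OF N])
    show "(h k has_real_derivative h (Suc k) x) (at x)" for k x
    proof -
      have "cos (a * x - \<phi> + real (Suc k) * (pi / 2)) = cos (a * x - \<phi> + real k * (pi / 2) + pi / 2)"
        by (simp add: algebra_simps add_divide_distrib)
      also have "\<dots> = - sin (a * x - \<phi> + real k * (pi / 2))"
        by (simp add: cos_add)
      finally have *: "h (Suc k) x = a ^ k * (- sin (a * x - \<phi> + real k * (pi / 2)) * a)"
        by (simp add: h_def)
      show ?thesis
        unfolding * unfolding h_def by (auto intro!: derivative_eq_intros)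
    qed
    show "\<bar>h (Suc N) x\<bar> \<le> \<bar>a\<bar> ^ Suc N" for x
      unfolding h_def abs_mult power_abs[symmetric] by (intro mult_left_le) auto
  qed
  also have "\<dots> \<le> \<bar>a\<bar> ^ Suc N / fact (Suc N) * (4 / 4 ^ Suc N)"
    by (intro mult_left_mono prod_cheb_node_bound N v divide_nonneg_nonneg) auto
  also have "\<dots> = 4 * ((1 / 2) ^ Suc N * ((\<bar>a\<bar> / 2) ^ Suc N / fact (Suc N)))"
  proof -
    have "(4::real) ^ Suc N = 2 ^ Suc N * 2 ^ Suc N" by (simp flip: power_mult_distrib)
    then show ?thesis by (simp add: power_divide field_simps del: power_Suc fact_Suc)
  qed
  also have "\<dots> \<le> 4 * (exp (- real N / 2) * exp (\<bar>a\<bar> / 2))"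
  proof (intro mult_left_mono mult_mono)
    have "(1 / 2 :: real) ^ Suc N \<le> (1 / 2) ^ N" by (simp add: power_decreasing)
    also have "\<dots> \<le> exp (- (1 / 2)) ^ N"
    proof (rule power_mono)
      show "1 / 2 \<le> exp (- (1 / 2) :: real)" using exp_ge_add_one_self[of "- (1 / 2)"] by simp
    qed simp
    also have "\<dots> = exp (- real N / 2)" by (simp flip: exp_of_nat_mult)
    finally show "(1 / 2 :: real) ^ Suc N \<le> exp (- real N / 2)" .
    \<comment> \<open>A single term of the exponential series.\<close>
    have "(\<bar>a\<bar> / 2) ^ Suc N /\<^sub>R fact (Suc N) \<le> exp (\<bar>a\<bar> / 2)"
      unfolding exp_def using summable_exp_generic[of "\<bar>a\<bar> / 2"]
      by (intro sum_le_suminf[of _ "{Suc N}", simplified]) auto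
    then show "(\<bar>a\<bar> / 2) ^ Suc N / fact (Suc N) \<le> exp (\<bar>a\<bar> / 2)"
      by (simp only: real_scaleR_def divide_inverse_commute)
  qed simp_all
  also have "\<dots> = 4 * exp ((\<bar>a\<bar> - real N) / 2)"
    by (simp add: diff_divide_distrib flip: exp_add)
  finally show ?thesis unfolding Z_def .
qed

section \<open>Integration against a signed measure\<close>

lemma sets_pos_part [simp]: "sets (pos_part M \<mu>) = sets M"
  and space_pos_part [simp]: "space (pos_part M \<mu>) = space M"
  by (simp_all add: pos_part_def sets.space_closed)

text \<open>
  \<open>\<mu> B - \<mu> C\<close> does not see the common part of \<open>B\<close> and \<open>C\<close>, and the two differences are disjoint, so
  that they belong to one partition of the space.
\<close>

lemma total_variation_upper_diff:
  assumes \<mu>: "signed_measure M \<mu>" and B: "B \<in> sets M" and C: "C \<in> sets M"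
  shows "ennreal (\<mu> B - \<mu> C) \<le> total_variation M \<mu>"
proof -
  define D where "D = B - C"
  define E where "E = C - B"
  define R where "R = space M - (D \<union> E)"
  let ?P = "{D, E, R} - {{}}"
  have DE: "D \<in> sets M" "E \<in> sets M" "R \<in> sets M" using B C by (auto simp: D_def E_def R_def)
  have empty: "\<mu> {} = 0" using \<mu> by (simp add: signed_measure_def)
  have "\<mu> (D \<union> (B \<inter> C)) = \<mu> D + \<mu> (B \<inter> C)" "\<mu> (E \<union> (B \<inter> C)) = \<mu> E + \<mu> (B \<inter> C)"
    using B C DE by (auto intro!: signed_measure_Un[OF \<mu>] simp: D_def E_def)
  moreover have "D \<union> (B \<inter> C) = B" "E \<union> (B \<inter> C) = C" by (auto simp: D_def E_def)
  ultimately have diff: "\<mu> B - \<mu> C = \<mu> D - \<mu> E" by simp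
  show ?thesis
  proof (cases "D = E")
    case True
    then show ?thesis by (simp add: diff)
  next
    case False
    have "ennreal (\<mu> B - \<mu> C) \<le> ennreal (\<bar>\<mu> D\<bar> + \<bar>\<mu> E\<bar>)"
      unfolding diff by (intro ennreal_leI) linarith
    also have "\<dots> = (\<Sum>A\<in>{D, E}. ennreal \<bar>\<mu> A\<bar>)" using False by (simp add: ennreal_plus)
    also have "\<dots> = (\<Sum>A\<in>{D, E} - {{}}. ennreal \<bar>\<mu> A\<bar>)"
      by (intro sum.mono_neutral_right) (auto simp: empty)
    also have "\<dots> \<le> (\<Sum>A\<in>?P. ennreal \<bar>\<mu> A\<bar>)" by (intro sum_mono2) auto
    also have "\<dots> \<le> total_variation M \<mu>"
      unfolding total_variation_def
    proof (rule SUP_upper)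
      have "\<Union>?P = D \<union> E \<union> R" by auto
      also have "\<dots> = space M"
        using sets.sets_into_space[OF DE(1)] sets.sets_into_space[OF DE(2)]
        unfolding R_def by blast
      finally have "\<Union>?P = space M" .
      moreover have "D \<inter> E = {}" "D \<inter> R = {}" "E \<inter> R = {}"
        by (auto simp: D_def E_def R_def)
      then have "disjoint ?P" by (auto simp: disjoint_def)
      ultimately show "?P \<in> {P. finite P \<and> P \<subseteq> sets M \<and> partition_on (space M) P}"
        using DE by (auto simp: partition_on_def)
    qed
    finally show ?thesis .
  qed
qed

text \<open>
  The total mass of the Jordan decomposition is at most the total variation. (They are equal, but
  only this inequality is needed.)
\<close>

lemma pos_part_add_neg_part_le:
  assumes \<mu>: "signed_measure M \<mu>"
  shows "emeasure (pos_part M \<mu>) (space M) + emeasure (neg_part M \<mu>) (space M)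
           \<le> total_variation M \<mu>"
proof -
  let ?S = "{B \<in> sets M. B \<subseteq> space M}"
  have ne: "?S \<noteq> {}" by auto
  have key: "ennreal (\<mu> B) + ennreal (- \<mu> C) \<le> total_variation M \<mu>"
    if "B \<in> ?S" "C \<in> ?S" for B C
  proof -
    \<comment> \<open>\<^const>\<open>ennreal\<close> truncates negative values to 0, which is the value at the empty set.\<close>
    define B' where "B' = (if 0 \<le> \<mu> B then B else {})"
    define C' where "C' = (if \<mu> C \<le> 0 then C else {})"
    have empty: "\<mu> {} = 0" using \<mu> by (simp add: signed_measure_def)
    have "ennreal (\<mu> B) + ennreal (- \<mu> C) = ennreal (\<mu> B') + ennreal (- \<mu> C')"
      by (auto simp: B'_def C'_def empty ennreal_neg)
    also have "\<dots> = ennreal (\<mu> B' - \<mu> C')"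
      by (subst ennreal_plus[symmetric]) (auto simp: B'_def C'_def empty)
    also have "\<dots> \<le> total_variation M \<mu>"
      using that by (intro total_variation_upper_diff[OF \<mu>]) (auto simp: B'_def C'_def)
    finally show ?thesis .
  qed
  have "ennreal (\<mu> B) + emeasure (neg_part M \<mu>) (space M) \<le> total_variation M \<mu>"
    if "B \<in> ?S" for B
    unfolding neg_part_def emeasure_pos_part[OF signed_measure_uminus[OF \<mu>] sets.top]
    using that key by (subst ennreal_SUP_add_right[OF ne]) (auto intro!: SUP_least)
  then show ?thesis
    unfolding emeasure_pos_part[OF \<mu> sets.top]
    by (subst ennreal_SUP_add_left[symmetric, OF ne]) (auto intro!: SUP_least)
qed

lemma finite_measure_pos_part:
  assumes "signed_measure M \<mu>" and "total_variation M \<mu> < \<infinity>"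
  shows "finite_measure (pos_part M \<mu>)"
  using emeasure_pos_part_finite[OF assms(1) sets.top assms(2)]
  by (intro finite_measureI) auto

lemma finite_measure_neg_part:
  assumes "signed_measure M \<mu>" and "total_variation M \<mu> < \<infinity>"
  shows "finite_measure (neg_part M \<mu>)"
  unfolding neg_part_def using assms
  by (intro finite_measure_pos_part signed_measure_uminus) (simp_all add: total_variation_uminus)

lemma AE_pos_part_support:
  assumes \<mu>: "signed_measure M \<mu>" and S: "S \<in> sets M"
    and supp: "\<And>A. A \<in> sets M \<Longrightarrow> A \<inter> S = {} \<Longrightarrow> \<mu> A = 0"
  shows "AE x in pos_part M \<mu>. x \<in> S"
proof (rule AE_I)
  show "{x \<in> space (pos_part M \<mu>). x \<notin> S} \<subseteq> space M - S" by auto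
  have "emeasure (pos_part M \<mu>) (space M - S)
      = (SUP B \<in> {B \<in> sets M. B \<subseteq> space M - S}. ennreal (\<mu> B))"
    using S by (intro emeasure_pos_part[OF \<mu>]) auto
  also have "\<dots> = (SUP B \<in> {B \<in> sets M. B \<subseteq> space M - S}. 0)"
  proof (intro SUP_cong refl)
    fix B assume "B \<in> {B \<in> sets M. B \<subseteq> space M - S}"
    then have "\<mu> B = 0" by (intro supp) auto
    then show "ennreal (\<mu> B) = 0" by simp
  qed
  also have "\<dots> \<le> 0" by (intro SUP_least) auto
  finally show "emeasure (pos_part M \<mu>) (space M - S) = 0" by simp
  show "space M - S \<in> sets (pos_part M \<mu>)" using S by simp
qed

lemma (in finite_measure) norm_integral_le_measure:
  fixes \<phi> :: "'a \<Rightarrow> 'b::{banach, second_countable_topology}"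
  assumes "\<phi> \<in> borel_measurable M" and "AE x in M. norm (\<phi> x) \<le> B"
  shows "norm (integral\<^sup>L M \<phi>) \<le> B * measure M (space M)"
proof -
  have "integrable M \<phi>" using assms by (intro integrable_const_bound)
  have "norm (integral\<^sup>L M \<phi>) \<le> (\<integral>x. norm (\<phi> x) \<partial>M)" by (rule integral_norm_bound)
  also have "\<dots> \<le> (\<integral>x. B \<partial>M)"
    using \<open>integrable M \<phi>\<close> assms(2) by (intro integral_mono_AE) auto
  finally show ?thesis by (simp add: mult.commute)
qed

lemma norm_signed_integral_le:
  fixes \<phi> :: "'a \<Rightarrow> 'b::{banach, second_countable_topology}"
  assumes \<mu>: "signed_measure M \<mu>" and fin: "total_variation M \<mu> < \<infinity>"
    and S: "S \<in> sets M" and supp: "\<And>A. A \<in> sets M \<Longrightarrow> A \<inter> S = {} \<Longrightarrow> \<mu> A = 0"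
    and \<phi>: "\<phi> \<in> borel_measurable M" and B: "\<And>x. x \<in> S \<Longrightarrow> norm (\<phi> x) \<le> B" and "0 \<le> B"
  shows "norm (signed_integral M \<mu> \<phi>) \<le> B * enn2real (total_variation M \<mu>)"
proof -
  interpret P: finite_measure "pos_part M \<mu>" by (rule finite_measure_pos_part[OF \<mu> fin])
  interpret N: finite_measure "neg_part M \<mu>" by (rule finite_measure_neg_part[OF \<mu> fin])
  have sets_N [simp]: "sets (neg_part M \<mu>) = sets M" "space (neg_part M \<mu>) = space M"
    by (simp_all add: neg_part_def)
  have AE_P: "AE x in pos_part M \<mu>. norm (\<phi> x) \<le> B"
    using AE_pos_part_support[of M \<mu> S] \<mu> S supp by (auto intro: B elim: eventually_mono)
  have "AE x in neg_part M \<mu>. x \<in> S"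
    unfolding neg_part_def using supp
    by (intro AE_pos_part_support signed_measure_uminus \<mu> S) auto
  then have AE_N: "AE x in neg_part M \<mu>. norm (\<phi> x) \<le> B"
    by eventually_elim (rule B)
  have meas: "\<phi> \<in> borel_measurable (pos_part M \<mu>)" "\<phi> \<in> borel_measurable (neg_part M \<mu>)"
    using \<phi> by (simp_all cong: measurable_cong_sets)
  have "ennreal (measure (pos_part M \<mu>) (space M) + measure (neg_part M \<mu>) (space M))
      \<le> total_variation M \<mu>"
    using pos_part_add_neg_part_le[OF \<mu>]
    by (simp add: ennreal_plus P.emeasure_eq_measure N.emeasure_eq_measure)
  also have "\<dots> = ennreal (enn2real (total_variation M \<mu>))"
    using fin by simp
  finally have mass: "measure (pos_part M \<mu>) (space M) + measure (neg_part M \<mu>) (space M)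
      \<le> enn2real (total_variation M \<mu>)"
    by (subst (asm) ennreal_le_iff) auto
  have "norm (signed_integral M \<mu> \<phi>)
      \<le> norm (integral\<^sup>L (pos_part M \<mu>) \<phi>) + norm (integral\<^sup>L (neg_part M \<mu>) \<phi>)"
    unfolding signed_integral_def by (rule norm_triangle_ineq4)
  also have "\<dots> \<le> B * measure (pos_part M \<mu>) (space M) + B * measure (neg_part M \<mu>) (space M)"
    using P.norm_integral_le_measure[OF meas(1) AE_P] N.norm_integral_le_measure[OF meas(2) AE_N]
    by simp
  also have "\<dots> \<le> B * enn2real (total_variation M \<mu>)"
    using mult_left_mono[OF mass \<open>0 \<le> B\<close>] by (simp add: distrib_left)
  finally show ?thesis .
qed

section \<open>Interpolation error and rank of a bandlimited function\<close>

lemma bandlimited_interp_bound: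
  fixes g :: "real \<Rightarrow> real"
  assumes g: "bandlimited_with \<Omega> \<mu> g" and N: "N \<ge> 1" and v: "v \<in> {0..1}"
  shows "interp_err m N g u v \<le> 2 * tv_norm \<mu> / pi * exp ((\<Omega> / 2 ^ m - real N) / 2)"
proof -
  have \<mu>: "signed_measure borel \<mu>" and fin: "total_variation borel \<mu> < \<infinity>"
    and supp: "\<And>A. A \<in> sets borel \<Longrightarrow> A \<inter> {-\<Omega>..\<Omega>} = {} \<Longrightarrow> \<mu> A = 0"
    and g_eq: "\<And>x. complex_of_real (g x) =
        1 / (2 * pi) * signed_integral borel \<mu> (\<lambda>\<omega>. cis (\<omega> * x))"
    using g by (auto simp: bandlimited_with_def cis_conv_exp)
  define e where "e x \<omega> = cis (\<omega> * x)" for x \<omega> :: real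
  define l where "l \<alpha> = complex_of_real (lagrange_basis N \<alpha> v)" for \<alpha>
  define y where "y \<alpha> = u + cheb_node N \<alpha> / 2 ^ m" for \<alpha>
  define \<phi> where "\<phi> \<omega> = e (u + v / 2 ^ m) \<omega> - (\<Sum>\<alpha>=0..N. e (y \<alpha>) \<omega> * l \<alpha>)" for \<omega>
  define B where "B = 4 * exp ((\<Omega> / 2 ^ m - real N) / 2)"
  interpret P: finite_measure "pos_part borel \<mu>" by (rule finite_measure_pos_part[OF \<mu> fin])
  interpret Q: finite_measure "neg_part borel \<mu>" by (rule finite_measure_neg_part[OF \<mu> fin])
  have e_meas [measurable]: "e x \<in> borel_measurable borel" for x
    unfolding e_def cis_conv_exp
    by (intro borel_measurable_continuous_onI continuous_intros)
  have int: "integrable (pos_part borel \<mu>) (e x)" "integrable (neg_part borel \<mu>) (e x)" for x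
  proof -
    have "e x \<in> borel_measurable (pos_part borel \<mu>)" "e x \<in> borel_measurable (neg_part borel \<mu>)"
      using e_meas by (simp_all add: neg_part_def cong: measurable_cong_sets)
    then show "integrable (pos_part borel \<mu>) (e x)" "integrable (neg_part borel \<mu>) (e x)"
      by (auto intro!: P.integrable_const_bound[of _ 1] Q.integrable_const_bound[of _ 1]
          simp: e_def)
  qed
  have "signed_integral borel \<mu> \<phi> = signed_integral borel \<mu> (e (u + v / 2 ^ m)) -
      (\<Sum>\<alpha>=0..N. signed_integral borel \<mu> (e (y \<alpha>)) * l \<alpha>)"
    unfolding signed_integral_def \<phi>_def using int
    by (simp add: left_diff_distrib sum_subtractf)
  then have "complex_of_real (g (u + v / 2 ^ m) - (\<Sum>\<alpha>=0..N. g (y \<alpha>) * lagrange_basis N \<alpha> v))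
      = 1 / (2 * pi) * signed_integral borel \<mu> \<phi>"
    by (simp add: g_eq e_def[abs_def] l_def right_diff_distrib sum_distrib_left mult.assoc)
  then have "interp_err m N g u v = norm (1 / (2 * pi) * signed_integral borel \<mu> \<phi>)"
    unfolding interp_err_def y_def by (metis norm_of_real)
  also have "\<dots> = 1 / (2 * pi) * norm (signed_integral borel \<mu> \<phi>)"
    by (simp add: norm_mult norm_divide)
  also have "\<dots> \<le> 1 / (2 * pi) * (B * tv_norm \<mu>)"
  proof (rule mult_left_mono)
    show "norm (signed_integral borel \<mu> \<phi>) \<le> B * tv_norm \<mu>"
      unfolding tv_norm_def
    proof (rule norm_signed_integral_le[OF \<mu> fin _ supp])
      show "\<phi> \<in> borel_measurable borel" unfolding \<phi>_def by measurable
      fix \<omega> assume \<omega>: "\<omega> \<in> {-\<Omega>..\<Omega>}"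
      \<comment> \<open>Translation by \<open>u\<close> is a factor of modulus 1; scaling by \<open>1 / 2 ^ m\<close> changes the frequency.\<close>
      define a where "a = \<omega> / 2 ^ m"
      have "\<phi> \<omega> = cis (\<omega> * u) * (cis (a * v) -
          (\<Sum>\<alpha>=0..N. cis (a * cheb_node N \<alpha>) * of_real (lagrange_basis N \<alpha> v)))"
        by (simp add: \<phi>_def e_def y_def l_def a_def right_diff_distrib sum_distrib_left
            mult.assoc[symmetric] cis_mult distrib_left)
      then have "norm (\<phi> \<omega>) \<le> 4 * exp ((\<bar>a\<bar> - real N) / 2)"
        using cis_interp_bound[OF N v, of a] by (simp add: norm_mult)
      also have "\<bar>a\<bar> \<le> \<Omega> / 2 ^ m"
        using \<omega> by (auto simp: a_def abs_divide intro!: divide_right_mono)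
      then have "4 * exp ((\<bar>a\<bar> - real N) / 2) \<le> B"
        unfolding B_def
      by (intro mult_left_mono exp_le_cancel_iff[THEN iffD2] divide_right_mono diff_right_mono) auto
      finally show "norm (\<phi> \<omega>) \<le> B" .
    qed (auto simp: B_def)
  qed auto
  also have "\<dots> = 2 * tv_norm \<mu> / pi * exp ((\<Omega> / 2 ^ m - real N) / 2)"
    by (simp add: B_def)
  finally show ?thesis .
qed

lemma cheb_node_in_unit_interval: "cheb_node N \<alpha> \<in> {0..1}"
proof -
  define c where "c = cos (pi * real \<alpha> / real N)"
  have "- 1 \<le> c" "c \<le> 1" unfolding c_def by (rule cos_ge_minus_one, rule cos_le_one)
  then show ?thesis by (simp add: cheb_node_def flip: c_def)
qed

lemma dyadic_shift_in_unit_interval: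
  fixes u v :: real
  assumes "u \<in> {0 .. 1 - 1 / 2 ^ m}" and "v \<in> {0..1}"
  shows "u + v / 2 ^ m \<in> {0..1}"
proof -
  have "v / 2 ^ m \<le> 1 / 2 ^ m" using assms(2) by (intro divide_right_mono) auto
  then show ?thesis using assms by simp
qed

lemma interp_err_cong:
  assumes fg: "\<forall>x \<in> {0..1}. f x = g x" and u: "u \<in> {0 .. 1 - 1 / 2 ^ m}" and v: "v \<in> {0..1}"
  shows "interp_err m N f u v = interp_err m N g u v"
  unfolding interp_err_def using fg dyadic_shift_in_unit_interval[OF u]
    cheb_node_in_unit_interval v by simp

text \<open>
  The number with binary expansion \<open>0.s\<^sub>1s\<^sub>2\<dots>\<close> given by a list of digits \<open>s\<close>; list positions are
  counted from 0, hence the index \<open>k - 1\<close>.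
\<close>

definition dyadic :: "nat list \<Rightarrow> real" where
  "dyadic s = (\<Sum>k = 1..length s. real (s ! (k - 1)) / 2 ^ k)"

lemma quantized_tensor_dyadic: "s \<in> bits K \<Longrightarrow> quantized_tensor K f s = f (dyadic s)"
  by (simp add: quantized_tensor_def dyadic_def bits_def)

lemma dyadic_append: "dyadic (s @ t) = dyadic s + dyadic t / 2 ^ length s"
proof -
  let ?f = "\<lambda>k. real ((s @ t) ! (k - 1)) / 2 ^ k"
  have "dyadic (s @ t) = sum ?f {1..length s} + sum ?f {length s + 1..length s + length t}"
    unfolding dyadic_def length_append by (rule sum.ub_add_nat) simp
  also have "sum ?f {1..length s} = dyadic s"
    unfolding dyadic_def by (intro sum.cong) (auto simp: nth_append)
  also have "sum ?f {length s + 1..length s + length t} = sum (\<lambda>k. ?f (k + length s)) {1..length t}"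
    using sum.shift_bounds_cl_nat_ivl[of ?f 1 "length s" "length t"] by (simp add: add.commute)
  also have "\<dots> = dyadic t / 2 ^ length s"
    unfolding dyadic_def sum_divide_distrib
    by (intro sum.cong) (auto simp: nth_append power_add)
  finally show ?thesis .
qed

lemma dyadic_range:
  assumes "set s \<subseteq> {0, 1}"
  shows "dyadic s \<in> {0 .. 1 - 1 / 2 ^ length s}"
  using assms
proof (induction s rule: rev_induct)
  case (snoc b s)
  then have "dyadic (s @ [b]) = dyadic s + (real b / 2) / 2 ^ length s"
    by (subst dyadic_append) (simp add: dyadic_def)
  moreover have "real b / 2 / 2 ^ length s \<le> 1 / 2 / 2 ^ length s"
    using snoc.prems by (intro divide_right_mono) auto
  ultimately show ?case using snoc by simp
qed (simp add: dyadic_def)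

lemma finite_bits: "finite (bits K)" and bits_nonempty: "bits K \<noteq> {}"
proof -
  have "bits K = {s. set s \<subseteq> {0, 1} \<and> length s = K}" by (auto simp: bits_def)
  then show "finite (bits K)" by (simp add: finite_lists_length_eq)
  have "replicate K 0 \<in> bits K" by (auto simp: bits_def)
  then show "bits K \<noteq> {}" by auto
qed

lemma tensor_norm_le_iff: "tensor_norm K S \<le> \<epsilon> \<longleftrightarrow> (\<forall>s\<in>bits K. \<bar>S s\<bar> \<le> \<epsilon>)"
  unfolding tensor_norm_def using finite_bits[of K] bits_nonempty[of K] by (subst Max_le_iff) auto

text \<open>
  With \<open>s\<close> and \<open>t\<close> the digits before and after position \<open>m\<close>, the value at \<open>u + v / 2 ^ m\<close>, where
  \<open>u = dyadic s\<close> and \<open>v = dyadic t\<close>, is approximated by the sum over \<open>\<alpha> = 0, \<dots>, N\<close> of the products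
  of \<open>f (u + cheb_node N \<alpha> / 2 ^ m)\<close> and \<open>lagrange_basis N \<alpha> v\<close>.
\<close>

lemma eps_rank_le_interp:
  assumes "m \<le> K"
    and err: "\<And>u v. u \<in> {0 .. 1 - 1 / 2 ^ m} \<Longrightarrow> v \<in> {0..1} \<Longrightarrow> interp_err m N f u v \<le> \<epsilon>"
  shows "eps_rank K m \<epsilon> (quantized_tensor K f) \<le> Suc N"
  unfolding eps_rank_def
proof (rule Least_le, intro exI)
  define L where "L \<alpha> s = f (dyadic s + cheb_node N \<alpha> / 2 ^ m)" for \<alpha> s
  define R where "R \<alpha> s = lagrange_basis N \<alpha> (dyadic s)" for \<alpha> s
  show "tensor_norm K (\<lambda>s. quantized_tensor K f s - (\<Sum>\<alpha><Suc N. tensor_prod m (L \<alpha>) (R \<alpha>) s)) \<le> \<epsilon>"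
    unfolding tensor_norm_le_iff
  proof
    fix s assume s: "s \<in> bits K"
    then have len: "length (take m s) = m" using \<open>m \<le> K\<close> by (simp add: bits_def)
    have sub: "set (take m s) \<subseteq> {0, 1}" "set (drop m s) \<subseteq> {0, 1}"
      using s set_take_subset[of m s] set_drop_subset[of m s] by (auto simp: bits_def)
    have u: "dyadic (take m s) \<in> {0 .. 1 - 1 / 2 ^ m}"
      using dyadic_range[OF sub(1)] unfolding len .
    have "dyadic (drop m s) \<le> 1 - 1 / 2 ^ length (drop m s)" "0 \<le> dyadic (drop m s)"
      using dyadic_range[OF sub(2)] by auto
    moreover have "0 \<le> (1::real) / 2 ^ length (drop m s)" by simp
    ultimately have v: "dyadic (drop m s) \<in> {0..1}" unfolding atLeastAtMost_iff by linarith
    have "dyadic s = dyadic (take m s) + dyadic (drop m s) / 2 ^ m"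
      using dyadic_append[of "take m s" "drop m s"] by (simp only: append_take_drop_id len)
    then have "\<bar>quantized_tensor K f s - (\<Sum>\<alpha><Suc N. tensor_prod m (L \<alpha>) (R \<alpha>) s)\<bar>
        = interp_err m N f (dyadic (take m s)) (dyadic (drop m s))"
      using s by (simp add: quantized_tensor_dyadic interp_err_def tensor_prod_def L_def R_def
          lessThan_Suc_atMost atMost_atLeast0 del: sum.lessThan_Suc)
    then show "\<bar>quantized_tensor K f s - (\<Sum>\<alpha><Suc N. tensor_prod m (L \<alpha>) (R \<alpha>) s)\<bar> \<le> \<epsilon>"
      using err[OF u v] by simp
  qed
qed

lemma exp_le_of_log_plus:
  fixes X \<epsilon> A :: real
  assumes "0 \<le> X" and "\<epsilon> > 0" and n: "A + 2 * log_plus (X / \<epsilon>) \<le> n"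
  shows "X * exp ((A - n) / 2) \<le> \<epsilon>"
proof (cases "X = 0")
  case False
  then have "X / \<epsilon> > 0" using assms by simp
  then have "ln (X / \<epsilon>) \<le> log_plus (X / \<epsilon>)" by (simp add: log_plus_def)
  then have "(A - n) / 2 \<le> - ln (X / \<epsilon>)" using n by simp
  then have "exp ((A - n) / 2) \<le> exp (- ln (X / \<epsilon>))" by simp
  also have "\<dots> = \<epsilon> / X" using \<open>X / \<epsilon> > 0\<close> by (simp add: exp_minus)
  finally show ?thesis using False \<open>0 \<le> X\<close> by (simp add: field_simps)
qed (use assms in simp)

theorem proposition8:
  fixes f g :: "real \<Rightarrow> real" and \<mu> :: "real set \<Rightarrow> real" and \<Omega> :: real
  assumes "\<Omega> > 0"
    and "bandlimited_with \<Omega> \<mu> g"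
    and "\<forall>x \<in> {0..1}. f x = g x"
  shows "(\<forall>m N. m \<ge> 1 \<longrightarrow> N \<ge> 1 \<longrightarrow>
            interp_error m N f \<le> 2 * tv_norm \<mu> / pi * exp ((\<Omega> / 2 ^ m - real N) / 2)) \<and>
         (\<forall>m K \<epsilon>. m \<ge> 1 \<longrightarrow> K > m \<longrightarrow> \<epsilon> > 0 \<longrightarrow>
            int (eps_rank K m \<epsilon> (quantized_tensor K f))
              \<le> 1 + \<lceil>\<Omega> / 2 ^ m + 2 * log_plus (2 * tv_norm \<mu> / (pi * \<epsilon>))\<rceil>)"
proof (intro conjI allI impI)
  have err: "interp_err m N f u v \<le> 2 * tv_norm \<mu> / pi * exp ((\<Omega> / 2 ^ m - real N) / 2)"
    if "N \<ge> 1" "u \<in> {0 .. 1 - 1 / 2 ^ m}" "v \<in> {0..1}" for m N u v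
    using bandlimited_interp_bound[OF assms(2) that(1,3), of m u]
      interp_err_cong[OF assms(3) that(2,3), of N] by simp
  show "interp_error m N f \<le> 2 * tv_norm \<mu> / pi * exp ((\<Omega> / 2 ^ m - real N) / 2)"
    if "m \<ge> 1" "N \<ge> 1" for m N
    unfolding interp_error_def using err[OF that(2)] by (intro cSUP_least) (force split: prod.split)+
  show "int (eps_rank K m \<epsilon> (quantized_tensor K f))
      \<le> 1 + \<lceil>\<Omega> / 2 ^ m + 2 * log_plus (2 * tv_norm \<mu> / (pi * \<epsilon>))\<rceil>"
    if "m \<ge> 1" "K > m" "\<epsilon> > 0" for m K \<epsilon>
  proof -
    \<comment> \<open>Positivity of \<open>\<Omega>\<close> enters through \<open>q > 0\<close>, which makes \<open>N\<close> at least 1.\<close>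
    define X where "X = 2 * tv_norm \<mu> / pi"
    define q where "q = \<Omega> / 2 ^ m + 2 * log_plus (X / \<epsilon>)"
    define N where "N = nat \<lceil>q\<rceil>"
    have "0 < \<Omega> / 2 ^ m" using assms(1) by simp
    moreover have "0 \<le> log_plus (X / \<epsilon>)" by (simp add: log_plus_def)
    ultimately have "q > 0" by (simp add: q_def)
    then have N: "N \<ge> 1" "int N = \<lceil>q\<rceil>" "q \<le> real N" by (auto simp: N_def) linarith+
    have "0 \<le> X" by (simp add: X_def tv_norm_def)
    then have "X * exp ((\<Omega> / 2 ^ m - real N) / 2) \<le> \<epsilon>"
      using \<open>\<epsilon> > 0\<close> N(3) by (intro exp_le_of_log_plus) (auto simp: q_def)
    then have "eps_rank K m \<epsilon> (quantized_tensor K f) \<le> Suc N"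
      using \<open>K > m\<close> err[OF N(1)] by (intro eps_rank_le_interp) (force simp: X_def)+
    then have "int (eps_rank K m \<epsilon> (quantized_tensor K f)) \<le> 1 + \<lceil>q\<rceil>"
      using N(2) by linarith
    then show ?thesis by (simp add: q_def X_def)
  qed
qed

end
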